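(* Let $G_1=C(T_1,\ldots,T_{g_1})$ and $G_2=C(T'_1,\ldots,T'_{g_2})$ be unicyclic graphs, each of which has a perfect matching and each of which has Laplacian eigenvalue $2$, and let $G=G_1\odot G_2$ be a bicyclic graph obtained as a one-edge connection of $G_1$ and $G_2$. Let $s_1$ be the number of trees among $T_1,\ldots,T_{g_1}$ that have odd order, and let $s_2$ be the number of trees among $T'_1,\ldots,T'_{g_2}$ that have odd order. Then $s_1\equiv s_2\equiv 0\pmod 4$ if and only if $2$ is an eigenvalue of the Laplacian matrix $L(G)$.
   Context: All graphs are finite, undirected, with no loops or multiple edges. The Laplacian matrix of $G$ is $L(G)=D(G)-A(G)$, where $D(G)$ is the diagonal matrix of vertex degrees and $A(G)$ is the adjacency matrix; the Laplacian eigenvalues of $G$ are the eigenvalues of $L(G)$. A unicyclic graph is a connected graph whose number of edges equals its number of vertices; it consists of a cycle $C_g$ with vertices $v_1,\ldots,v_g$ and, for each $i$, a rooted tree $T_i$ of order $n_i\ge 1$ with root $v_i$, where $V(T_i)\cap V(C_g)=\{v_i\}$. Such a graph is denoted by $C(T_1,\ldots,T_g)$. A one-edge connection $G_1\odot G_2$ of two (vertex-disjoint) graphs $G_1,G_2$ is any graph $G$ with $V(G)=V(G_1)\cup V(G_2)$ and $E(G)=E(G_1)\cup E(G_2)\cup\{uv\}$ for some $u\in V(G_1)$ and $v\in V(G_2)$. A one-edge connection of two unicyclic graphs is a bicyclic graph. *)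

theory Defs
  imports
    "Jordan_Normal_Form.Char_Poly"
    "HOL-Library.Countable_Set"
    "HOL-Number_Theory.Cong"
begin

record 'a ugraph =
  verts :: "'a set"
  edges :: "'a set set"

definition simple_graph :: "'a ugraph \<Rightarrow> bool" where
  "simple_graph G \<longleftrightarrow> finite (verts G) \<and> (\<forall>e\<in>edges G. e \<subseteq> verts G \<and> card e = 2)"

definition adj_rel :: "'a ugraph \<Rightarrow> ('a \<times> 'a) set" where
  "adj_rel G = {(u, v). {u, v} \<in> edges G}"

definition connected_graph :: "'a ugraph \<Rightarrow> bool" where
  "connected_graph G \<longleftrightarrow>
     verts G \<noteq> {} \<and> (\<forall>u\<in>verts G. \<forall>v\<in>verts G. (u, v) \<in> (adj_rel G)\<^sup>*)"

definition vertex_degree :: "'a ugraph \<Rightarrow> 'a \<Rightarrow> nat" where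
  "vertex_degree G v = card {e \<in> edges G. v \<in> e}"

text \<open>
  The library's matrices are indexed by natural numbers, so the vertices are enumerated:
  for finite \<^term>\<open>verts G\<close>, \<^term>\<open>vertex_at G\<close> is a bijection from
  \<^term>\<open>{..<card (verts G)}\<close> onto \<^term>\<open>verts G\<close>.  The choice of the enumeration is
  irrelevant for the eigenvalues, see \<open>eigenvalue_laplacian_iff\<close> below.
\<close>

definition vertex_at :: "'a ugraph \<Rightarrow> nat \<Rightarrow> 'a" where
  "vertex_at G = from_nat_into (verts G)"

definition degree_matrix :: "'a ugraph \<Rightarrow> real mat" where
  "degree_matrix G = mat (card (verts G)) (card (verts G))
     (\<lambda>(i, j). if i = j then real (vertex_degree G (vertex_at G i)) else 0)"

definition adjacency_matrix :: "'a ugraph \<Rightarrow> real mat" where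
  "adjacency_matrix G = mat (card (verts G)) (card (verts G))
     (\<lambda>(i, j). if {vertex_at G i, vertex_at G j} \<in> edges G then 1 else 0)"

definition laplacian_matrix :: "'a ugraph \<Rightarrow> real mat" where
  "laplacian_matrix G = degree_matrix G - adjacency_matrix G"

definition has_perfect_matching :: "'a ugraph \<Rightarrow> bool" where
  "has_perfect_matching G \<longleftrightarrow> (\<exists>M \<subseteq> edges G. pairwise disjnt M \<and> \<Union>M = verts G)"

definition unicyclic :: "'a ugraph \<Rightarrow> bool" where
  "unicyclic G \<longleftrightarrow> simple_graph G \<and> connected_graph G \<and> card (edges G) = card (verts G)"

text \<open>The edges of the closed walk through a list of vertices; a cycle if the list is
  distinct and has length at least 3.\<close>

definition cycle_edges :: "'a list \<Rightarrow> 'a set set" where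
  "cycle_edges vs = {{vs ! i, vs ! (Suc i mod length vs)} | i. i < length vs}"

definition tree_graph :: "'a ugraph \<Rightarrow> bool" where
  "tree_graph T \<longleftrightarrow> simple_graph T \<and> connected_graph T \<and>
     \<not> (\<exists>vs. distinct vs \<and> length vs \<ge> 3 \<and> cycle_edges vs \<subseteq> edges T)"

text \<open>
  A family of rooted trees \<open>(v\<^sub>1, T\<^sub>1), \<dots>, (v\<^sub>g, T\<^sub>g)\<close> that can be placed on a cycle:
  the trees are pairwise vertex-disjoint, so \<open>T\<^sub>i\<close> meets the cycle through the roots
  \<open>v\<^sub>1, \<dots>, v\<^sub>g\<close> only in \<open>v\<^sub>i\<close>.
\<close>

definition cycle_tree_family :: "('a \<times> 'a ugraph) list \<Rightarrow> bool" where
  "cycle_tree_family Ts \<longleftrightarrow> length Ts \<ge> 3 \<and>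
     (\<forall>(v, T) \<in> set Ts. tree_graph T \<and> v \<in> verts T) \<and>
     (\<forall>i j. i < j \<and> j < length Ts \<longrightarrow>
        verts (snd (Ts ! i)) \<inter> verts (snd (Ts ! j)) = {})"

text \<open>The graph \<open>C(T\<^sub>1, \<dots>, T\<^sub>g)\<close>.\<close>

definition cycle_of_trees :: "('a \<times> 'a ugraph) list \<Rightarrow> 'a ugraph" where
  "cycle_of_trees Ts =
     \<lparr>verts = (\<Union>(v, T) \<in> set Ts. verts T),
      edges = (\<Union>(v, T) \<in> set Ts. edges T) \<union> cycle_edges (map fst Ts)\<rparr>"

definition num_odd_trees :: "('a \<times> 'a ugraph) list \<Rightarrow> nat" where
  "num_odd_trees Ts = card {i. i < length Ts \<and> odd (card (verts (snd (Ts ! i))))}"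

definition one_edge_connection :: "'a ugraph \<Rightarrow> 'a ugraph \<Rightarrow> 'a ugraph \<Rightarrow> bool" where
  "one_edge_connection G1 G2 G \<longleftrightarrow> verts G1 \<inter> verts G2 = {} \<and>
     (\<exists>u \<in> verts G1. \<exists>v \<in> verts G2.
        G = \<lparr>verts = verts G1 \<union> verts G2,
             edges = edges G1 \<union> edges G2 \<union> {{u, v}}\<rparr>)"

lemma bij_betw_vertex_at:
  assumes "finite (verts G)"
  shows "bij_betw (vertex_at G) {..<card (verts G)} (verts G)"
  unfolding vertex_at_def by (rule bij_betw_from_nat_into_finite[OF assms])

lemma laplacian_matrix_carrier [simp]:
  "dim_row (laplacian_matrix G) = card (verts G)"
  "dim_col (laplacian_matrix G) = card (verts G)"
  by (simp_all add: laplacian_matrix_def adjacency_matrix_def)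

lemma eigenvalue_laplacian_iff:
  assumes "simple_graph G"
  shows "eigenvalue (laplacian_matrix G) k \<longleftrightarrow>
    (\<exists>x. (\<exists>v\<in>verts G. x v \<noteq> 0) \<and>
         (\<forall>v\<in>verts G. real (vertex_degree G v) * x v - (\<Sum>w | {v, w} \<in> edges G. x w) = k * x v))"
    (is "_ \<longleftrightarrow> (\<exists>x. ?nz x \<and> ?ev x)")
proof -
  let ?n = "card (verts G)" and ?f = "vertex_at G"
  let ?L = "laplacian_matrix G"
  have fin: "finite (verts G)" using assms by (simp add: simple_graph_def)
  note bij = bij_betw_vertex_at[OF fin]
  have inj: "inj_on ?f {..<?n}" and im: "?f ` {..<?n} = verts G"
    using bij by (auto simp: bij_betw_def)
  have allv: "(\<forall>v\<in>verts G. P v) \<longleftrightarrow> (\<forall>i<?n. P (?f i))" for P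
  proof -
    have "(\<forall>v\<in>?f ` {..<?n}. P v) \<longleftrightarrow> (\<forall>i<?n. P (?f i))" by blast
    then show ?thesis by (simp only: im)
  qed
  have nbrs: "{w. {v, w} \<in> edges G} = {w \<in> verts G. {v, w} \<in> edges G}" for v
    using assms by (auto simp: simple_graph_def)
  have row: "(?L *\<^sub>v vec ?n (\<lambda>j. x (?f j))) $ i =
      real (vertex_degree G (?f i)) * x (?f i) - (\<Sum>w | {?f i, w} \<in> edges G. x w)"
    if i: "i < ?n" for i and x :: "'a \<Rightarrow> real"
  proof -
    have "(?L *\<^sub>v vec ?n (\<lambda>j. x (?f j))) $ i = (\<Sum>j<?n. ?L $$ (i, j) * x (?f j))"
      using i by (auto simp: scalar_prod_def lessThan_atLeast0 intro!: sum.cong)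
    also have "\<dots> = (\<Sum>j<?n. (if i = j then real (vertex_degree G (?f i)) * x (?f i) else 0)
        - (if {?f i, ?f j} \<in> edges G then x (?f j) else 0))"
      using i by (intro sum.cong refl)
        (auto simp: laplacian_matrix_def degree_matrix_def adjacency_matrix_def algebra_simps)
    also have "\<dots> = real (vertex_degree G (?f i)) * x (?f i)
        - (\<Sum>j<?n. if {?f i, ?f j} \<in> edges G then x (?f j) else 0)"
      using i by (simp add: sum_subtractf sum.delta')
    also have "(\<Sum>j<?n. if {?f i, ?f j} \<in> edges G then x (?f j) else 0)
        = (\<Sum>w\<in>verts G. if {?f i, w} \<in> edges G then x w else 0)"
      by (rule sum.reindex_bij_betw[OF bij, of "\<lambda>w. if {?f i, w} \<in> edges G then x w else 0"])
    also have "\<dots> = (\<Sum>w | {?f i, w} \<in> edges G. x w)"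
      unfolding nbrs[of "?f i"] by (rule sum.inter_filter[OF fin, symmetric])
    finally show ?thesis .
  qed
  have key: "eigenvector ?L (vec ?n (\<lambda>j. x (?f j))) k \<longleftrightarrow> ?nz x \<and> ?ev x"
    for x :: "'a \<Rightarrow> real"
  proof -
    have nz: "vec ?n (\<lambda>j. x (?f j)) \<noteq> 0\<^sub>v ?n \<longleftrightarrow> ?nz x"
      using allv[of "\<lambda>v. x v = 0"] by (auto simp: vec_eq_iff)
    have "?L *\<^sub>v vec ?n (\<lambda>j. x (?f j)) = k \<cdot>\<^sub>v vec ?n (\<lambda>j. x (?f j)) \<longleftrightarrow>
        (\<forall>i<?n. (?L *\<^sub>v vec ?n (\<lambda>j. x (?f j))) $ i = k * x (?f i))"
      by (auto simp: vec_eq_iff simp del: index_mult_mat_vec)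
    also have "\<dots> \<longleftrightarrow> (\<forall>i<?n. real (vertex_degree G (?f i)) * x (?f i)
        - (\<Sum>w | {?f i, w} \<in> edges G. x w) = k * x (?f i))"
      by (simp add: row[where x = x] del: index_mult_mat_vec)
    also have "\<dots> \<longleftrightarrow> ?ev x"
      by (rule allv[of "\<lambda>v. real (vertex_degree G v) * x v
        - (\<Sum>w | {v, w} \<in> edges G. x w) = k * x v", symmetric])
    finally show ?thesis using nz by (simp add: eigenvector_def)
  qed
  show ?thesis
  proof
    assume "eigenvalue ?L k"
    then obtain y where y: "eigenvector ?L y k" unfolding eigenvalue_def by blast
    define x where "x v = y $ (the_inv_into {..<?n} ?f v)" for v
    have dim: "dim_vec y = ?n"
      using y unfolding eigenvector_def laplacian_matrix_carrier by (blast dest: carrier_vecD)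
    have "vec ?n (\<lambda>j. x (?f j)) = y"
    proof (rule eq_vecI)
      fix i assume "i < dim_vec y"
      then show "vec ?n (\<lambda>j. x (?f j)) $ i = y $ i"
        using dim by (simp add: x_def the_inv_into_f_f[OF inj])
    qed (simp add: dim)
    then have "?nz x \<and> ?ev x" using key[of x] y by simp
    then show "\<exists>x. ?nz x \<and> ?ev x" by (rule exI[where x = x])
  next
    assume "\<exists>x. ?nz x \<and> ?ev x"
    then obtain x where "?nz x \<and> ?ev x" by blast
    then have "eigenvector ?L (vec ?n (\<lambda>j. x (?f j))) k" by (rule key[of x, THEN iffD2])
    then show "eigenvalue ?L k" unfolding eigenvalue_def by (rule exI)
  qed
qed

end

theory Submission
  imports Defs
begin

text \<open>
  Both sides of the equivalence are consequences of the hypotheses.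

  Let \<open>x\<close> be an eigenvector of a unicyclic graph with perfect matching for the eigenvalue \<open>2\<close>.
  Working up each tree from its leaves, the tree \<open>T\<^sub>n\<close> contributes \<open>0\<close> to the eigenvalue
  equation at its root \<open>v\<^sub>n\<close> if \<open>v\<^sub>n\<close> is matched along the cycle (odd order), and \<open>2 x(v\<^sub>n)\<close>
  otherwise (even order). Hence \<open>y\<^sub>n = x(v\<^sub>n)\<close> satisfies \<open>y\<^sub>n\<^sub>+\<^sub>2 + y\<^sub>n = 0\<close> or
  \<open>y\<^sub>n\<^sub>+\<^sub>2 + y\<^sub>n = 2 y\<^sub>n\<^sub>+\<^sub>1\<close> respectively. Passing a matched cycle edge changes the sign of the
  solution, so if their number were odd, the solution would have to be zero on the cycle and then
  everywhere. Each matched cycle edge joins two odd trees, so the number of odd trees is a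
  multiple of \<open>4\<close>.

  Conversely, eigenvectors of the two parts always glue to one of the one-edge connection.
\<close>

section \<open>The Laplacian as a sum of differences over neighbours\<close>

definition nbrs :: "'a set set \<Rightarrow> 'a \<Rightarrow> 'a set" where
  "nbrs E v = {w. {v, w} \<in> E}"

text \<open>In this form an edge whose ends carry equal values contributes nothing, and an added
  edge costs one summand at each end.\<close>

definition lap :: "'a set set \<Rightarrow> ('a \<Rightarrow> real) \<Rightarrow> 'a \<Rightarrow> real" where
  "lap E x v = (\<Sum>w\<in>nbrs E v. x v - x w)"

lemma lap_cong: "nbrs E v = nbrs E' v \<Longrightarrow> lap E x v = lap E' x v"
  by (simp add: lap_def)

lemma nbrs_subset: "\<forall>e\<in>E. e \<subseteq> V \<Longrightarrow> nbrs E v \<subseteq> V"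
  by (auto simp: nbrs_def)

lemma edge_endpoints: "\<forall>e\<in>E. e \<subseteq> V \<Longrightarrow> {a, b} \<in> E \<Longrightarrow> a \<in> V \<and> b \<in> V"
  by blast

text \<open>Sending a neighbour \<open>w\<close> to \<open>{v, w}\<close> is a bijection onto the
  edges at \<open>v\<close>, so the degree can be absorbed into the sum over neighbours.\<close>

lemma laplacian_row_eq_lap:
  assumes "simple_graph G"
  shows "real (vertex_degree G v) * x v - (\<Sum>w | {v, w} \<in> edges G. x w) = lap (edges G) x v"
proof -
  have E: "\<forall>e\<in>edges G. card e = 2" using assms by (auto simp: simple_graph_def)
  have "bij_betw (\<lambda>w. {v, w}) (nbrs (edges G) v) {e \<in> edges G. v \<in> e}"
    unfolding bij_betw_def
  proof
    show "inj_on (\<lambda>w. {v, w}) (nbrs (edges G) v)"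
      by (auto simp: inj_on_def doubleton_eq_iff)
    show "(\<lambda>w. {v, w}) ` nbrs (edges G) v = {e \<in> edges G. v \<in> e}"
    proof (intro equalityI subsetI)
      fix e assume e: "e \<in> {e \<in> edges G. v \<in> e}"
      then have "card e = 2" using E by simp
      then obtain a b where "e = {a, b}" by (auto simp: card_2_iff)
      then have "e = {v, a} \<or> e = {v, b}" using e by auto
      then show "e \<in> (\<lambda>w. {v, w}) ` nbrs (edges G) v"
        using e by (auto simp: nbrs_def)
    qed (auto simp: nbrs_def)
  qed
  then have "card (nbrs (edges G) v) = vertex_degree G v"
    by (simp add: vertex_degree_def bij_betw_same_card)
  then show ?thesis by (simp add: lap_def sum_subtractf) (simp add: nbrs_def)
qed

lemma eigenvalue_laplacian_iff_lap:
  assumes "simple_graph G"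
  shows "eigenvalue (laplacian_matrix G) k \<longleftrightarrow>
    (\<exists>x. (\<exists>v\<in>verts G. x v \<noteq> 0) \<and> (\<forall>v\<in>verts G. lap (edges G) x v = k * x v))"
  unfolding eigenvalue_laplacian_iff[OF assms] laplacian_row_eq_lap[OF assms] ..

section \<open>Eigenvectors on rooted trees\<close>

text \<open>Trees are cut along an edge at the root, so an induction splits a matching into its
  parts in \<open>E\<close> and \<open>F\<close> and possibly the edge
  \<open>{r, c}\<close>.\<close>

inductive rooted_tree :: "'a \<Rightarrow> 'a set \<Rightarrow> 'a set set \<Rightarrow> bool" where
  single: "rooted_tree r {r} {}"
| join: "rooted_tree r A E \<Longrightarrow> rooted_tree c B F \<Longrightarrow> A \<inter> B = {} \<Longrightarrow>
    rooted_tree r (A \<union> B) (insert {r, c} (E \<union> F))"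

lemma rooted_tree_wf:
  assumes "rooted_tree r V E"
  shows "r \<in> V" "finite V" "\<forall>e\<in>E. e \<subseteq> V"
  using assms by (induction rule: rooted_tree.induct) auto

text \<open>
  A child \<open>c\<close> of \<open>r\<close> satisfies \<open>x c = \<plusminus> x r\<close>, the sign being positive iff \<open>c\<close> is matched
  to one of its own children.
\<close>

lemma rooted_tree_lap:
  assumes "rooted_tree r V E" "M \<subseteq> E" "pairwise disjnt M" "V - {r} \<subseteq> \<Union>M"
    and "\<forall>w\<in>V - {r}. lap E x w = 2 * x w"
  shows "lap E x r = (if r \<in> \<Union>M then 2 * x r else 0) \<and> (x r = 0 \<longrightarrow> (\<forall>w\<in>V. x w = 0))"
  using assms
proof (induction arbitrary: M rule: rooted_tree.induct)
  case (single r)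
  then show ?case by (auto simp: lap_def nbrs_def)
next
  case (join r A E c B F)
  let ?T = "insert {r, c} (E \<union> F)"
  note A = rooted_tree_wf[OF join.hyps(1)] and B = rooted_tree_wf[OF join.hyps(2)]
  have AB: "A \<inter> B = {}" by fact
  have rc: "r \<notin> B" "c \<notin> A" "r \<noteq> c" using A B AB by auto
  have nA: "nbrs E w \<subseteq> A" and nB: "nbrs F w \<subseteq> B" for w
    using nbrs_subset[OF A(3)] nbrs_subset[OF B(3)] by auto
  have lA: "lap ?T x w = lap E x w" if "w \<in> A - {r}" for w
    using that AB rc
    by (intro lap_cong) (auto simp: nbrs_def doubleton_eq_iff dest: edge_endpoints[OF B(3)])
  have lB: "lap ?T x w = lap F x w" if "w \<in> B - {c}" for w
    using that AB rc
    by (intro lap_cong) (auto simp: nbrs_def doubleton_eq_iff dest: edge_endpoints[OF A(3)])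
  have "nbrs ?T r = insert c (nbrs E r)"
    using AB rc by (auto simp: nbrs_def doubleton_eq_iff dest: edge_endpoints[OF B(3)])
  moreover have "c \<notin> nbrs E r" "finite (nbrs E r)"
    using rc nA[of r] finite_subset[OF nA A(2)] by auto
  ultimately have lr: "lap ?T x r = lap E x r + x r - x c" by (simp add: lap_def)
  have "nbrs ?T c = insert r (nbrs F c)"
    using AB rc by (auto simp: nbrs_def doubleton_eq_iff dest: edge_endpoints[OF A(3)])
  moreover have "r \<notin> nbrs F c" "finite (nbrs F c)"
    using rc nB[of c] finite_subset[OF nB B(2)] by auto
  ultimately have lc: "lap ?T x c = lap F x c + x c - x r" by (simp add: lap_def)
  have lc2: "lap ?T x c = 2 * x c" using join.prems(4) B(1) rc by auto
  have MA: "A - {r} \<subseteq> \<Union>(M \<inter> E)"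
  proof
    fix w assume w: "w \<in> A - {r}"
    then obtain e where e: "e \<in> M" "w \<in> e" using join.prems(3) rc by blast
    then have "e \<in> E" using join.prems(1) w rc AB B(3) by auto
    with e show "w \<in> \<Union>(M \<inter> E)" by auto
  qed
  have MB: "B - {c} \<subseteq> \<Union>(M \<inter> F)"
  proof
    fix w assume w: "w \<in> B - {c}"
    then obtain e where e: "e \<in> M" "w \<in> e" using join.prems(3) rc by blast
    then have "e \<in> F" using join.prems(1) w rc AB A(3) by auto
    with e show "w \<in> \<Union>(M \<inter> F)" by auto
  qed
  have IA: "lap E x r = (if r \<in> \<Union>(M \<inter> E) then 2 * x r else 0) \<and>
      (x r = 0 \<longrightarrow> (\<forall>w\<in>A. x w = 0))"
    using join.prems(2,4) lA MA by (intro join.IH(1)) (auto intro: pairwise_subset)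
  have eqB: "\<forall>w\<in>B - {c}. lap F x w = 2 * x w"
  proof
    fix w assume w: "w \<in> B - {c}"
    then show "lap F x w = 2 * x w" using lB[OF w] bspec[OF join.prems(4), of w] rc by auto
  qed
  have IB: "lap F x c = (if c \<in> \<Union>(M \<inter> F) then 2 * x c else 0) \<and>
      (x c = 0 \<longrightarrow> (\<forall>w\<in>B. x w = 0))"
    by (rule join.IH(2)[OF _ pairwise_subset[OF join.prems(2)] MB eqB]) auto
  \<comment> \<open>The eigenvalue equation at \<open>c\<close> reads
    \<open>lap F x c + x c - x r = 2 * x c\<close>, and the first term is \<open>2 * x c\<close> or
    \<open>0\<close>.\<close>
  have xc: "x r = (if c \<in> \<Union>(M \<inter> F) then x c else - x c)"
    using conjunct1[OF IB] lc lc2 by (cases "c \<in> \<Union>(M \<inter> F)") (simp_all del: Union_iff)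
  have "x c = 0" if "x r = 0" using xc that by (simp split: if_splits del: Union_iff)
  then have zero: "x r = 0 \<longrightarrow> (\<forall>w\<in>A \<union> B. x w = 0)" using IA IB by blast
  \<comment> \<open>If \<open>{r, c}\<close> is matched, then \<open>x c = - x r\<close> and the new
    edge adds \<open>2 * x r\<close> at a root unmatched in \<open>E\<close>; otherwise
    \<open>x c = x r\<close> and it adds nothing.\<close>
  show ?case
  proof (cases "{r, c} \<in> M")
    case True
    have "\<not> r \<in> \<Union>(M \<inter> E)"
    proof
      assume "r \<in> \<Union>(M \<inter> E)"
      then obtain e where e: "e \<in> M" "e \<in> E" "r \<in> e" by auto
      then have "e \<noteq> {r, c}" using A(3) rc by auto
      then show False using pairwiseD[OF join.prems(2) e(1) True] e(3) by (auto simp: disjnt_def)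
    qed
    moreover have "\<not> c \<in> \<Union>(M \<inter> F)"
    proof
      assume "c \<in> \<Union>(M \<inter> F)"
      then obtain e where e: "e \<in> M" "e \<in> F" "c \<in> e" by auto
      then have "e \<noteq> {r, c}" using B(3) rc by auto
      then show False using pairwiseD[OF join.prems(2) e(1) True] e(3) by (auto simp: disjnt_def)
    qed
    moreover have "r \<in> \<Union>M" using True by blast
    ultimately show ?thesis using conjunct1[OF IA] xc lr zero by (simp del: Union_iff)
  next
    case False
    have "c \<in> \<Union>M" using join.prems(3) B(1) rc by auto
    then have "c \<in> \<Union>(M \<inter> F)" using join.prems(1) False A(3) rc by blast
    moreover have "r \<in> \<Union>M \<longleftrightarrow> r \<in> \<Union>(M \<inter> E)" using join.prems(1) False B(3) rc by blast
    ultimately show ?thesis using conjunct1[OF IA] xc lr zero by (simp del: Union_iff)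
  qed
qed

section \<open>Connected acyclic graphs as rooted trees\<close>

lemma rtrancl_distinct_path:
  assumes "(u, v) \<in> R\<^sup>*"
  shows "\<exists>p. p \<noteq> [] \<and> hd p = u \<and> last p = v \<and> distinct p \<and> successively (\<lambda>a b. (a, b) \<in> R) p"
  using assms
proof (induction rule: converse_rtrancl_induct)
  case base
  show ?case by (rule exI[of _ "[v]"]) simp
next
  case (step u w)
  then obtain p where p: "p \<noteq> []" "hd p = w" "last p = v" "distinct p"
    "successively (\<lambda>a b. (a, b) \<in> R) p" by blast
  show ?case
  proof (cases "u \<in> set p")
    case True
    then obtain p1 p2 where "p = p1 @ u # p2" by (meson split_list)
    then show ?thesis using p
      by (intro exI[of _ "u # p2"]) (auto simp: successively_append_iff)
  next
    case False
    then show ?thesis using p step(1)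
      by (intro exI[of _ "u # p"]) (auto simp: successively_Cons)
  qed
qed

definition edge_rel :: "'a set set \<Rightarrow> ('a \<times> 'a) set" where
  "edge_rel E = {(u, v). {u, v} \<in> E}"

lemma sym_edge_rel_rtrancl: "(u, v) \<in> (edge_rel E)\<^sup>* \<Longrightarrow> (v, u) \<in> (edge_rel E)\<^sup>*"
proof -
  have "sym (edge_rel E)" by (auto simp: sym_def edge_rel_def insert_commute)
  then show "(u, v) \<in> (edge_rel E)\<^sup>* \<Longrightarrow> (v, u) \<in> (edge_rel E)\<^sup>*"
    by (meson sym_rtrancl symD)
qed

text \<open>A distinct path from \<open>r\<close> to \<open>c\<close> avoiding the edge
  \<open>{r, c}\<close> would close to a cycle with it.\<close>

lemma bridge_if_no_cycle:
  assumes "\<not> (\<exists>vs. distinct vs \<and> length vs \<ge> 3 \<and> cycle_edges vs \<subseteq> E)"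
    and "{r, c} \<in> E" "r \<noteq> c"
  shows "(r, c) \<notin> (edge_rel (E - {{r, c}}))\<^sup>*"
proof
  let ?R = "edge_rel (E - {{r, c}})"
  assume "(r, c) \<in> ?R\<^sup>*"
  from rtrancl_distinct_path[OF this] obtain p where p: "p \<noteq> []" "hd p = r" "last p = c"
    "distinct p" "successively (\<lambda>a b. (a, b) \<in> ?R) p" by blast
  have step: "{p ! i, p ! Suc i} \<in> E - {{r, c}}" if "Suc i < length p" for i
    using p(5) that by (auto simp: successively_conv_nth edge_rel_def)
  have hl: "p ! 0 = r" "p ! (length p - 1) = c"
    using p by (simp_all add: hd_conv_nth last_conv_nth)
  \<comment> \<open>One vertex would force \<open>r = c\<close>, and two vertices would use the
    deleted edge.\<close>
  have "length p \<noteq> 1" using hl assms(3) by auto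
  moreover have "length p \<noteq> 2" using hl step[of 0] by auto
  moreover have "length p \<noteq> 0" using p(1) by simp
  ultimately have len: "length p \<ge> 3" by linarith
  have "{p ! i, p ! (Suc i mod length p)} \<in> E" if "i < length p" for i
  proof (cases "Suc i < length p")
    case True
    then show ?thesis using step[of i] by simp
  next
    case False
    then have "i = length p - 1" "Suc i = length p" using that by auto
    then show ?thesis using hl assms(2) by (simp add: insert_commute)
  qed
  then have "cycle_edges p \<subseteq> E" by (auto simp: cycle_edges_def)
  then show False using assms(1) p(4) len by blast
qed

lemma component_tree_graph:
  fixes E :: "'a set set"
  defines "C r \<equiv> {w. (r, w) \<in> (edge_rel E)\<^sup>*}"
  assumes "finite V" "\<forall>e\<in>E. e \<subseteq> V \<and> card e = 2" "r \<in> V"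
    and "\<not> (\<exists>vs. distinct vs \<and> length vs \<ge> 3 \<and> cycle_edges vs \<subseteq> E)"
  shows "tree_graph \<lparr>verts = C r, edges = {e \<in> E. e \<subseteq> C r}\<rparr>" and "C r \<subseteq> V"
proof -
  show CV: "C r \<subseteq> V"
  proof
    fix w assume "w \<in> C r"
    then have "(r, w) \<in> (edge_rel E)\<^sup>*" by (simp add: C_def)
    then show "w \<in> V"
      by (induction rule: rtrancl_induct) (use assms in \<open>auto simp: edge_rel_def\<close>)
  qed
  let ?F = "{e \<in> E. e \<subseteq> C r}"
  \<comment> \<open>A walk from \<open>r\<close> never leaves \<open>C r\<close>, so it survives the
    restriction of the edges.\<close>
  have reach: "(r, w) \<in> (edge_rel ?F)\<^sup>*" if "(r, w) \<in> (edge_rel E)\<^sup>*" for w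
    using that
  proof (induction rule: rtrancl_induct)
    case (step y z)
    then have "y \<in> C r" "z \<in> C r" by (auto simp: C_def intro: rtrancl_into_rtrancl)
    then have "(y, z) \<in> edge_rel ?F" using step(2) by (simp add: edge_rel_def)
    then show ?case using step.IH by (rule rtrancl_into_rtrancl[rotated])
  qed simp
  have "(u, v) \<in> (edge_rel ?F)\<^sup>*" if "u \<in> C r" "v \<in> C r" for u v
    using rtrancl_trans[OF sym_edge_rel_rtrancl[OF reach] reach] that by (simp add: C_def)
  moreover have "r \<in> C r" by (simp add: C_def)
  moreover have "finite (C r)" using CV assms(2) by (rule finite_subset)
  moreover have "\<not> (\<exists>vs. distinct vs \<and> length vs \<ge> 3 \<and> cycle_edges vs \<subseteq> ?F)"
    using assms(5) by blast
  ultimately show "tree_graph \<lparr>verts = C r, edges = ?F\<rparr>"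
    using assms(3)
    by (auto simp: tree_graph_def simple_graph_def connected_graph_def adj_rel_def edge_rel_def)
qed

text \<open>Strong induction on the order: an edge \<open>{r, c}\<close> at the root is a bridge, so
  deleting it leaves two smaller trees rooted at \<open>r\<close> and \<open>c\<close>, which
  \<open>join\<close> reassembles.\<close>

lemma tree_graph_rooted_tree:
  assumes "tree_graph T" "r \<in> verts T"
  shows "rooted_tree r (verts T) (edges T)"
  using assms
proof (induction "card (verts T)" arbitrary: T r rule: less_induct)
  case less
  let ?V = "verts T" and ?E = "edges T"
  have fin: "finite ?V" and E: "\<forall>e\<in>?E. e \<subseteq> ?V \<and> card e = 2"
    and conn: "\<And>u v. u \<in> ?V \<Longrightarrow> v \<in> ?V \<Longrightarrow> (u, v) \<in> (edge_rel ?E)\<^sup>*"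
    and ac: "\<not> (\<exists>vs. distinct vs \<and> length vs \<ge> 3 \<and> cycle_edges vs \<subseteq> ?E)"
    using less.prems(1)
    by (auto simp: tree_graph_def simple_graph_def connected_graph_def adj_rel_def edge_rel_def)
  show ?case
  proof (cases "\<exists>c. {r, c} \<in> ?E")
    case False
    have "w = r" if "w \<in> ?V" for w
      using conn[OF less.prems(2) that] False
      by (cases rule: converse_rtranclE) (auto simp: edge_rel_def)
    then have V: "?V = {r}" using less.prems(2) by blast
    have "?E = {}"
    proof (rule ccontr)
      assume "?E \<noteq> {}"
      then obtain e where "e \<in> ?E" by auto
      then have "e \<subseteq> {r}" "card e = 2" using E V by auto
      then show False using card_mono[of "{r}" e] by simp
    qed
    then show ?thesis using V rooted_tree.single[of r] by simp
  next
    case True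
    then obtain c where c: "{r, c} \<in> ?E" by blast
    have rc: "r \<noteq> c" "c \<in> ?V" using c E by fastforce+
    let ?E' = "?E - {{r, c}}"
    define C where "C u = {w. (u, w) \<in> (edge_rel ?E')\<^sup>*}" for u
    have E': "\<forall>e\<in>?E'. e \<subseteq> ?V \<and> card e = 2" using E by blast
    have ac': "\<not> (\<exists>vs. distinct vs \<and> length vs \<ge> 3 \<and> cycle_edges vs \<subseteq> ?E')" using ac by blast
    note comp = component_tree_graph[OF fin E' _ ac', folded C_def]
    have disj: "C r \<inter> C c = {}"
      using bridge_if_no_cycle[OF ac c rc(1)] unfolding C_def
      by (auto dest: sym_edge_rel_rtrancl intro: rtrancl_trans)
    have self: "u \<in> C u" for u by (simp add: C_def)
    have closed: "b \<in> C u" if "a \<in> C u" "{a, b} \<in> ?E'" for a b u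
      using that unfolding C_def by (auto simp: edge_rel_def intro: rtrancl_into_rtrancl)
    have "w \<in> C r \<union> C c" if "w \<in> ?V" for w
      using conn[OF less.prems(2) that]
    proof (induction rule: rtrancl_induct)
      case base
      show ?case using self by blast
    next
      case (step y z)
      then show ?case using closed[of y _ z] self[of r] self[of c]
        by (cases "{y, z} = {r, c}") (auto simp: edge_rel_def doubleton_eq_iff)
    qed
    then have V: "?V = C r \<union> C c" using comp(2) less.prems(2) rc(2) by blast
    have "e \<subseteq> C r \<or> e \<subseteq> C c" if e: "e \<in> ?E'" for e
    proof -
      obtain a b where ab: "e = {a, b}" using E' e by (meson card_2_iff)
      then have "a \<in> C r \<or> a \<in> C c" using E' e V by blast
      then show ?thesis using closed[of a _ b] e ab by blast
    qed
    then have Eq: "?E = insert {r, c} ({e \<in> ?E'. e \<subseteq> C r} \<union> {e \<in> ?E'. e \<subseteq> C c})"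
      using c by blast
    have "C r \<subset> ?V" "C c \<subset> ?V" using V disj self[of r] self[of c] by blast+
    then have "card (C r) < card ?V" "card (C c) < card ?V"
      using psubset_card_mono[OF fin] by blast+
    then have "rooted_tree r (C r) {e \<in> ?E'. e \<subseteq> C r}" "rooted_tree c (C c) {e \<in> ?E'. e \<subseteq> C c}"
      using less.hyps[OF _ comp(1)[OF less.prems(2)], of r] less.hyps[OF _ comp(1)[OF rc(2)], of c]
        self by simp_all
    from rooted_tree.join[OF this disj] show ?thesis using V Eq by simp
  qed
qed

section \<open>Matching cardinality and the recurrence around the cycle\<close>

lemma card_Union_matching:
  assumes "finite M" "\<forall>e\<in>M. card e = 2" "pairwise disjnt M"
  shows "card (\<Union>M) = 2 * card M"
  using card_Union_disjoint[of M] assms by (simp add: card_ge_0_finite)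

text \<open>A sign flipping at each index marked by \<open>m\<close> makes \<open>c\<close>
  constant. An odd number of flips per period also negates \<open>c\<close> after one period, so it
  is zero. Then \<open>e n * y n\<close> is constant and negated after one period, hence zero as
  well.\<close>

lemma twisted_periodic_sequence_zero:
  fixes y :: "nat \<Rightarrow> real" and m :: "nat \<Rightarrow> bool"
  assumes per: "\<And>n. y (n + g) = y n" "\<And>n. m (n + g) = m n"
    and rec: "\<And>n. y (n + 2) + y n = (if m n \<or> m (Suc n) then 0 else 2 * y (Suc n))"
    and adj: "\<And>n. \<not> (m n \<and> m (Suc n))"
    and odd: "odd (card {i. i < g \<and> m i})"
  shows "y n = 0"
proof -
  \<comment> \<open>\<open>e\<close> counts the sign changes; \<open>c\<close> is, up to sign, the difference of consecutive values of
    \<open>y\<close> before the next sign change, or their sum across one.\<close>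
  define e :: "nat \<Rightarrow> real" where "e n = (\<Prod>k<n. if m k then -1 else 1)" for n
  have e_Suc: "e (Suc n) = (if m n then - e n else e n)" for n by (simp add: e_def)
  have e_sq: "e n * e n = 1" for n by (induction n) (simp_all add: e_Suc, simp add: e_def)
  have "e g = (-1) ^ card {i. i < g \<and> m i}"
  proof -
    have "e g = (\<Prod>k | k \<in> {..<g} \<and> m k. -1)"
      unfolding e_def by (subst prod.inter_filter) simp_all
    then show ?thesis by simp
  qed
  then have eg: "e g = - 1" using odd by simp
  have e_per: "e (n + g) = - e n" for n
  proof (induction n)
    case 0
    then show ?case using eg by (simp add: e_def)
  next
    case (Suc n)
    then show ?case by (simp add: e_Suc per(2))
  qed
  define c where "c n = e n * y (Suc n) - e (Suc n) * y n" for n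
  have c_Suc: "c (Suc n) = c n" for n
  proof -
    have y2: "y (Suc (Suc n)) = (if m n \<or> m (Suc n) then 0 else 2 * y (Suc n)) - y n"
      using rec[of n] by (simp add: algebra_simps)
    show ?thesis using adj[of n] by (auto simp: c_def e_Suc y2 algebra_simps)
  qed
  have c_const: "c n = c 0" for n by (induction n) (simp_all add: c_Suc)
  have "c (0 + g) = - c 0" using e_per[of 0] e_per[of 1] per(1)[of 0] per(1)[of 1]
    by (simp add: c_def)
  then have "c n = 0" for n using c_const[of g] c_const[of n] by simp
  \<comment> \<open>The sign relating \<open>e n\<close> and \<open>e (Suc n)\<close> is its own
    inverse, so it may be moved to the other side of \<open>c n = 0\<close>.\<close>
  then have "e (Suc n) * y (Suc n) = e n * y n" for n
  proof -
    have "e n * y (Suc n) = e (Suc n) * y n" using \<open>c n = 0\<close> by (simp add: c_def)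
    then show ?thesis by (auto simp: e_Suc split: if_splits)
  qed
  then have w: "e n * y n = e 0 * y 0" for n by (induction n) simp_all
  have "e 0 * y 0 = 0" using w[of "0 + g"] e_per[of 0] per(1)[of 0] by simp
  then show ?thesis using w[of n] e_sq[of n] by auto
qed

section \<open>The number of odd trees on one cycle\<close>

text \<open>The recurrence for the roots rules out an odd number of matched cycle edges; the odd
  trees are then counted as the ends of those edges.\<close>

lemma num_odd_trees_mod_4_if_eigenvalue_2:
  assumes fam: "cycle_tree_family Ts" and G: "G = cycle_of_trees Ts" "simple_graph G"
    and pm: "has_perfect_matching G" and ev: "eigenvalue (laplacian_matrix G) 2"
  shows "[num_odd_trees Ts = 0] (mod 4)"
proof -
  define g where "g = length Ts"
  \<comment> \<open>Indices are taken modulo \<open>g\<close>, turning the cycle into periodic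
    sequences; most facts are stated at \<open>Suc n\<close>, so that the preceding root
    \<open>v n\<close> needs no subtraction.\<close>
  define v where "v n = fst (Ts ! (n mod g))" for n
  define V where "V n = verts (snd (Ts ! (n mod g)))" for n
  define F where "F n = edges (snd (Ts ! (n mod g)))" for n
  define e where "e n = {v n, v (Suc n)}" for n
  have g3: "g \<ge> 3" using fam by (simp add: cycle_tree_family_def g_def)
  then have g0: "g > 0" by simp
  have nth_in: "Ts ! (n mod g) \<in> set Ts" for n using g0 by (simp add: g_def)
  have tree: "tree_graph (snd (Ts ! (n mod g)))" and vV: "v n \<in> V n" for n
    using fam nth_in[of n] by (auto simp: cycle_tree_family_def v_def V_def split_beta)
  have rt: "rooted_tree (v n) (V n) (F n)" for n
    using tree_graph_rooted_tree[OF tree[of n], of "v n"] vV[of n] by (simp add: V_def F_def)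
  note wf = rooted_tree_wf[OF rt]
  have V_disj: "V a \<inter> V b = {}" if "a mod g \<noteq> b mod g" for a b
  proof -
    have d: "verts (snd (Ts ! i)) \<inter> verts (snd (Ts ! j)) = {}" if "i < j" "j < g" for i j
      using fam that by (simp add: cycle_tree_family_def g_def)
    have "a mod g < g" "b mod g < g" using g0 by simp_all
    then show ?thesis
      using that d[of "a mod g" "b mod g"] d[of "b mod g" "a mod g"] unfolding V_def
      by (metis Int_commute linorder_neq_iff)
  qed
  have V_mod: "a mod g = b mod g" if "w \<in> V a" "w \<in> V b" for a b w
    using V_disj[of a b] that by blast
  have v_mod: "v a = v b \<longleftrightarrow> a mod g = b mod g" for a b
    using V_mod[of "v a" a b] vV[of a] vV[of b] by (auto simp: v_def)
  have Suc_mod: "Suc a mod g = Suc b mod g \<longleftrightarrow> a mod g = b mod g" for a b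
    using cong_add_rcancel_nat[of a 1 b g] by (simp add: cong_def)
  \<comment> \<open>With \<open>g\<close> at least 3, a root and its two cycle neighbours are three
    different vertices.\<close>
  have n1: "n mod g \<noteq> Suc n mod g" and n2: "n mod g \<noteq> Suc (Suc n) mod g" for n
    using g3 by (simp_all add: mod_Suc)
  have v_neq: "v n \<noteq> v (Suc n)" "v n \<noteq> v (Suc (Suc n))" for n
    using n1 n2 by (simp_all add: v_mod)
  have e_mod: "e a = e b" if "a mod g = b mod g" for a b
    using that by (metis e_def v_mod Suc_mod)
  have set_Ts: "set Ts = (!) Ts ` {..<g}" by (auto simp: set_conv_nth g_def)
  have "(\<Union>n<g. V n) = (\<Union>n<g. verts (snd (Ts ! n)))" by (intro SUP_cong) (simp_all add: V_def)
  then have vertsG: "verts G = (\<Union>n<g. V n)"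
    unfolding G cycle_of_trees_def by (simp add: set_Ts split_beta)
  have "(\<Union>n<g. F n) = (\<Union>n<g. edges (snd (Ts ! n)))" by (intro SUP_cong) (simp_all add: F_def)
  moreover have "cycle_edges (map fst Ts) = e ` {..<g}"
    unfolding cycle_edges_def setcompr_eq_image length_map g_def[symmetric] lessThan_def[symmetric]
    by (intro image_cong) (use g0 in \<open>simp_all add: e_def v_def g_def\<close>)
  ultimately have edgesG: "edges G = (\<Union>n<g. F n) \<union> e ` {..<g}"
    unfolding G cycle_of_trees_def by (simp add: set_Ts split_beta)
  have VG: "V n \<subseteq> verts G" for n
    using g0 by (auto simp: vertsG V_def intro!: bexI[of _ "n mod g"])
  have FG: "F n \<subseteq> edges G" for n
    using g0 by (auto simp: edgesG F_def intro!: bexI[of _ "n mod g"])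
  have eG: "e n \<in> edges G" for n
    using g0 e_mod[of n "n mod g"] by (auto simp: edgesG)
  have edge_cases: "{a, b} \<in> F (Suc n) \<or> a = v (Suc n) \<and> (b = v n \<or> b = v (Suc (Suc n)))"
    if "{a, b} \<in> edges G" "a \<in> V (Suc n)" for a b n
    using that(1) unfolding edgesG
  proof
    assume "{a, b} \<in> (\<Union>n<g. F n)"
    then obtain k where k: "{a, b} \<in> F k" by auto
    then have "a \<in> V k" using edge_endpoints[OF wf(3)] by blast
    then have "k mod g = Suc n mod g" using V_mod that(2) by blast
    then show ?thesis using k by (simp add: F_def)
  next
    assume "{a, b} \<in> e ` {..<g}"
    then obtain k where "{a, b} = {v k, v (Suc k)}" by (auto simp: e_def)
    then consider "a = v k" "b = v (Suc k)" | "a = v (Suc k)" "b = v k"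
      by (auto simp: doubleton_eq_iff)
    then show ?thesis
    proof cases
      case 1
      then have "k mod g = Suc n mod g" using V_mod[OF _ that(2)] vV by blast
      then show ?thesis using 1 by (metis v_mod Suc_mod)
    next
      case 2
      then have "Suc k mod g = Suc n mod g" using V_mod[OF _ that(2)] vV by blast
      then show ?thesis using 2 by (metis v_mod Suc_mod)
    qed
  qed
  obtain M where M: "M \<subseteq> edges G" "pairwise disjnt M" "\<Union>M = verts G"
    using pm by (auto simp: has_perfect_matching_def)
  have same: "d = d'" if "d \<in> M" "d' \<in> M" "w \<in> d" "w \<in> d'" for d d' w
    using pairwiseD[OF M(2) that(1,2)] that(3,4) by (auto simp: disjnt_def)
  obtain x where x: "\<exists>w\<in>verts G. x w \<noteq> 0" "\<forall>w\<in>verts G. lap (edges G) x w = 2 * x w"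
    using ev eigenvalue_laplacian_iff_lap[OF G(2)] by blast
  define m where "m n \<longleftrightarrow> e n \<in> M" for n
  have m_mod: "m a = m b" if "a mod g = b mod g" for a b
    using e_mod[OF that] by (simp add: m_def)
  have card2: "card d = 2" if "d \<in> edges G" for d using G(2) that by (auto simp: simple_graph_def)
  have e_notF: "e n \<notin> F (Suc n)" "e (Suc n) \<notin> F (Suc n)" for n
  proof -
    have "v n \<notin> V (Suc n)" "v (Suc (Suc n)) \<notin> V (Suc n)"
      using V_mod[OF vV, of n "Suc n"] V_mod[OF vV, of "Suc (Suc n)" "Suc n"] n1[of n] n1[of "Suc n"]
      by auto
    then show "e n \<notin> F (Suc n)" "e (Suc n) \<notin> F (Suc n)"
      using edge_endpoints[OF wf(3)] unfolding e_def by blast+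
  qed
  have matched: "\<exists>b. {w, b} \<in> M" if "w \<in> V n" for w n
  proof -
    have "w \<in> \<Union>M" using that VG M(3) by blast
    then obtain d where d: "d \<in> M" "w \<in> d" by blast
    then have "card d = 2" using card2 M(1) by blast
    then obtain a b where "d = {a, b}" by (auto simp: card_2_iff)
    then have "d = {w, a} \<or> d = {w, b}" using d by auto
    then show ?thesis using d by blast
  qed
  have disj_MF: "pairwise disjnt (M \<inter> F n)" for n by (rule pairwise_subset[OF M(2)]) simp
  have cover: "V (Suc n) - {v (Suc n)} \<subseteq> \<Union>(M \<inter> F (Suc n))" for n
  proof
    fix w assume w: "w \<in> V (Suc n) - {v (Suc n)}"
    then obtain b where "{w, b} \<in> M" using matched by blast
    then show "w \<in> \<Union>(M \<inter> F (Suc n))" using edge_cases[of w b n] w M(1) by blast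
  qed
  have root: "v (Suc n) \<in> \<Union>(M \<inter> F (Suc n)) \<longleftrightarrow> \<not> (m n \<or> m (Suc n))" for n
  proof
    assume "v (Suc n) \<in> \<Union>(M \<inter> F (Suc n))"
    then obtain d where d: "d \<in> M" "d \<in> F (Suc n)" "v (Suc n) \<in> d" by blast
    have "v (Suc n) \<in> e n" "v (Suc n) \<in> e (Suc n)" by (simp_all add: e_def)
    then show "\<not> (m n \<or> m (Suc n))" using same d e_notF m_def by metis
  next
    assume nm: "\<not> (m n \<or> m (Suc n))"
    obtain b where b: "{v (Suc n), b} \<in> M" using matched vV by blast
    then have "b \<noteq> v n" "b \<noteq> v (Suc (Suc n))" using nm by (auto simp: m_def e_def insert_commute)
    then show "v (Suc n) \<in> \<Union>(M \<inter> F (Suc n))"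
      using edge_cases[of "v (Suc n)" b n] b M(1) vV by blast
  qed
  \<comment> \<open>The matching edges inside the tree cover an even number of vertices, namely all
    of them except possibly the root.\<close>
  have odd_iff: "odd (card (V (Suc n))) \<longleftrightarrow> m n \<or> m (Suc n)" for n
  proof -
    let ?N = "M \<inter> F (Suc n)"
    have sub: "\<Union>?N \<subseteq> V (Suc n)" using wf(3) by blast
    have "finite ?N" using finite_UnionD[of ?N] finite_subset[OF sub wf(2)] by blast
    moreover have "\<forall>d\<in>?N. card d = 2" using M(1) card2 by blast
    ultimately have even: "even (card (\<Union>?N))" by (simp add: card_Union_matching[OF _ _ disj_MF])
    show ?thesis
    proof (cases "v (Suc n) \<in> \<Union>?N")
      case True
      then have "\<Union>?N = V (Suc n)" using sub cover by blast
      then show ?thesis using even True root by metis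
    next
      case False
      then have "V (Suc n) = insert (v (Suc n)) (\<Union>?N)" using sub cover vV by blast
      then have "card (V (Suc n)) = Suc (card (\<Union>?N))"
        using False finite_subset[OF sub wf(2)] by simp
      then show ?thesis using even False root[of n] by simp
    qed
  qed
  have xV: "lap (edges G) x w = 2 * x w" if "w \<in> V n" for w n
    using x(2) VG that by blast
  have inner: "lap (F (Suc n)) x w = 2 * x w" if "w \<in> V (Suc n) - {v (Suc n)}" for n w
  proof -
    have "nbrs (edges G) w = nbrs (F (Suc n)) w"
      using that edge_cases[of w _ n] FG by (auto simp: nbrs_def)
    then have "lap (edges G) x w = lap (F (Suc n)) x w" by (rule lap_cong)
    then show ?thesis using xV[of w "Suc n"] that by simp
  qed
  have tl: "lap (F (Suc n)) x (v (Suc n)) = (if m n \<or> m (Suc n) then 0 else 2 * x (v (Suc n))) \<and>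
      (x (v (Suc n)) = 0 \<longrightarrow> (\<forall>w\<in>V (Suc n). x w = 0))" for n
    using rooted_tree_lap[OF rt Int_lower2 disj_MF cover, where x = x] root[of n] inner by simp
  \<comment> \<open>The two cycle edges add \<open>2 * x (v (Suc n))\<close> minus the neighbouring
    values; this cancels the right-hand side of the eigenvalue equation and leaves the contribution
    of the tree.\<close>
  have rec: "x (v (n + 2)) + x (v n) = (if m n \<or> m (Suc n) then 0 else 2 * x (v (Suc n)))" for n
  proof -
    have nb: "nbrs (edges G) (v (Suc n)) =
        insert (v n) (insert (v (Suc (Suc n))) (nbrs (F (Suc n)) (v (Suc n))))"
      using edge_cases[of "v (Suc n)" _ n] vV FG eG[of n] eG[of "Suc n"]
      by (auto simp: nbrs_def e_def insert_commute)
    have "v n \<notin> nbrs (F (Suc n)) (v (Suc n))" "v (Suc (Suc n)) \<notin> nbrs (F (Suc n)) (v (Suc n))"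
      using e_notF[of n] by (auto simp: nbrs_def e_def insert_commute)
    moreover have "finite (nbrs (F (Suc n)) (v (Suc n)))"
      using finite_subset[OF nbrs_subset[OF wf(3)] wf(2)] .
    ultimately have "lap (edges G) x (v (Suc n)) = lap (F (Suc n)) x (v (Suc n))
        + (x (v (Suc n)) - x (v n)) + (x (v (Suc n)) - x (v (Suc (Suc n))))"
      using v_neq(2)[of n] by (simp add: lap_def nb)
    then show ?thesis using tl[of n] xV[OF vV, of "Suc n"] by simp
  qed
  have adj: "\<not> (m n \<and> m (Suc n))" for n
  proof
    assume "m n \<and> m (Suc n)"
    then have "e n = e (Suc n)"
      using same[of "e n" "e (Suc n)" "v (Suc n)"] by (auto simp: m_def e_def)
    then show False using v_neq[of n] by (auto simp: e_def doubleton_eq_iff)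
  qed
  define S where "S = {i. i < g \<and> m i}"
  have "even (card S)"
  proof (rule ccontr)
    assume "odd (card S)"
    then have odd: "odd (card {i. i < g \<and> m i})" by (simp add: S_def)
    have per: "x (v (n + g)) = x (v n)" "m (n + g) = m n" for n
      by (simp add: v_def) (rule m_mod, simp)
    have y0: "x (v n) = 0" for n
      by (rule twisted_periodic_sequence_zero[of "\<lambda>n. x (v n)" g m, OF per rec adj odd])
    have z: "x w = 0" if "w \<in> V (Suc n)" for w n using tl[of n] y0[of "Suc n"] that by simp
    have "x w = 0" if w: "w \<in> verts G" for w
    proof -
      obtain n where n: "w \<in> V n" using w vertsG by blast
      \<comment> \<open>\<open>n + g - 1\<close> is the cyclic predecessor of \<open>n\<close>;
        \<open>z\<close> speaks of successors only.\<close>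
      have "V n = V (Suc (n + g - 1))" using g0 by (simp add: V_def)
      then show ?thesis using n z[of w "n + g - 1"] by simp
    qed
    then show False using x(1) by blast
  qed
  \<comment> \<open>A position \<open>i\<close> in \<open>S\<close> stands for the matched edge
    between the roots at \<open>i\<close> and \<open>?f i\<close>, so the odd trees sit at the two
    ends of these edges.\<close>
  let ?f = "\<lambda>i. Suc i mod g"
  have num: "num_odd_trees Ts = card {i. i < g \<and> odd (card (V i))}"
    unfolding num_odd_trees_def g_def[symmetric] by (intro arg_cong[where f = card]) (auto simp: V_def)
  have "{i. i < g \<and> odd (card (V i))} = S \<union> ?f ` S"
  proof (intro equalityI subsetI)
    fix i assume i: "i \<in> {i. i < g \<and> odd (card (V i))}"
    define n where "n = i + g - 1"
    have n: "Suc n mod g = i" "Suc n mod g = i mod g" using i g0 by (simp_all add: n_def)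
    then have "V (Suc n) = V i" by (simp add: V_def)
    then have "m n \<or> m (Suc n)" using odd_iff[of n] i by simp
    then show "i \<in> S \<union> ?f ` S"
    proof
      assume "m n"
      then have "n mod g \<in> S" using m_mod[of n "n mod g"] g0 by (simp add: S_def)
      moreover have "?f (n mod g) = i" using n(1) by (simp add: mod_Suc_eq)
      ultimately show ?thesis by blast
    next
      assume "m (Suc n)"
      then show ?thesis using m_mod[OF n(2)] i by (simp add: S_def)
    qed
  next
    fix i assume "i \<in> S \<union> ?f ` S"
    then show "i \<in> {i. i < g \<and> odd (card (V i))}"
    proof
      assume i: "i \<in> S"
      define n where "n = i + g - 1"
      have n: "Suc n mod g = i mod g" using g0 by (simp add: n_def)
      then have "V (Suc n) = V i" by (simp add: V_def)
      then show ?thesis using i odd_iff[of n] m_mod[OF n] by (simp add: S_def)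
    next
      assume "i \<in> ?f ` S"
      then obtain j where j: "j \<in> S" "i = Suc j mod g" by blast
      then have "V (Suc j) = V i" by (simp add: V_def)
      then show ?thesis using j odd_iff[of j] g0 by (simp add: S_def)
    qed
  qed
  \<comment> \<open>At a common position both cycle edges at the root would be matched, against
    \<open>adj\<close>.\<close>
  moreover have "S \<inter> ?f ` S = {}"
  proof -
    have "?f j \<notin> S" if "j \<in> S" for j
      using that adj[of j] m_mod[of "?f j" "Suc j"] by (simp add: S_def)
    then show ?thesis by blast
  qed
  moreover have "inj_on ?f S" using Suc_mod by (auto simp: inj_on_def S_def)
  moreover have "finite S" by (simp add: S_def)
  ultimately have "num_odd_trees Ts = 2 * card S"
    using num by (simp add: card_Un_disjoint card_image)
  then show ?thesis using \<open>even (card S)\<close> by (auto simp: cong_def elim!: evenE)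
qed

section \<open>Gluing eigenvectors across the new edge\<close>

text \<open>
  Eigenvectors of the two parts glue once they agree at the ends of the new edge, since that
  edge then contributes nothing to the Laplacian. Rescaling achieves this unless one of them
  vanishes at its end, in which case it can be extended by zero.
\<close>

lemma eigenvalue_laplacian_one_edge_connection:
  assumes G1: "simple_graph G1" and G2: "simple_graph G2" and G: "one_edge_connection G1 G2 G"
    and ev: "eigenvalue (laplacian_matrix G1) k" "eigenvalue (laplacian_matrix G2) k"
  shows "eigenvalue (laplacian_matrix G) k"
proof -
  obtain u v where disj: "verts G1 \<inter> verts G2 = {}" and uv: "u \<in> verts G1" "v \<in> verts G2"
    and V: "verts G = verts G1 \<union> verts G2"
    and E: "edges G = insert {u, v} (edges G1 \<union> edges G2)"
    using G by (auto simp: one_edge_connection_def)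
  have E1: "\<forall>e\<in>edges G1. e \<subseteq> verts G1" and E2: "\<forall>e\<in>edges G2. e \<subseteq> verts G2"
    and fin: "finite (verts G1)" "finite (verts G2)"
    using G1 G2 by (auto simp: simple_graph_def)
  have uv_neq: "u \<noteq> v" "u \<notin> verts G2" "v \<notin> verts G1" using disj uv by auto
  have G': "simple_graph G" using G1 G2 uv uv_neq(1) by (auto simp: simple_graph_def V E)
  have n1: "nbrs (edges G) w = nbrs (edges G1) w \<union> (if w = u then {v} else {})"
    if "w \<in> verts G1" for w
    using that disj uv_neq
    by (auto simp: nbrs_def E doubleton_eq_iff dest: edge_endpoints[OF E2])
  have n2: "nbrs (edges G) w = nbrs (edges G2) w \<union> (if w = v then {u} else {})"
    if "w \<in> verts G2" for w
    using that disj uv_neq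
    by (auto simp: nbrs_def E doubleton_eq_iff dest: edge_endpoints[OF E1])
  note nb = nbrs_subset[OF E1] nbrs_subset[OF E2]
  note fnb = finite_subset[OF nb(1) fin(1)] finite_subset[OF nb(2) fin(2)]
  have vn: "v \<notin> nbrs (edges G1) w" "u \<notin> nbrs (edges G2) w" for w using nb uv_neq by blast+
  obtain x1 where x1: "\<exists>w\<in>verts G1. x1 w \<noteq> 0" "\<forall>w\<in>verts G1. lap (edges G1) x1 w = k * x1 w"
    using ev(1) eigenvalue_laplacian_iff_lap[OF G1] by blast
  obtain x2 where x2: "\<exists>w\<in>verts G2. x2 w \<noteq> 0" "\<forall>w\<in>verts G2. lap (edges G2) x2 w = k * x2 w"
    using ev(2) eigenvalue_laplacian_iff_lap[OF G2] by blast
  \<comment> \<open>If \<open>x1\<close> vanishes at \<open>u\<close>, it is extended by zero;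
    otherwise cross-multiplication equalises the end values, and \<open>b = x1 u\<close> is nonzero
    even when \<open>x2 v = 0\<close>.\<close>
  obtain a b where ab: "a * x1 u = b * x2 v" "a \<noteq> 0 \<or> b \<noteq> 0"
  proof (cases "x1 u = 0")
    case True
    then show ?thesis using that[of 1 0] by simp
  next
    case False
    then show ?thesis using that[of "x2 v" "x1 u"] by simp
  qed
  define x where "x w = (if w \<in> verts G1 then a * x1 w else b * x2 w)" for w
  have xuv: "x u = x v" using ab(1) uv uv_neq by (simp add: x_def)
  have "lap (edges G) x w = k * x w" if w: "w \<in> verts G1" for w
  proof -
    \<comment> \<open>If \<open>w = u\<close>, the extra summand is
      \<open>x u - x v = 0\<close>.\<close>
    have "lap (edges G) x w = lap (edges G1) x w"
      using fnb(1) vn(1) xuv w uv(1) by (cases "w = u") (simp_all add: lap_def n1)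
    also have "\<dots> = a * lap (edges G1) x1 w"
      using w nb(1)[of w] unfolding lap_def sum_distrib_left
      by (intro sum.cong) (auto simp: x_def algebra_simps)
    finally show ?thesis using x1(2) w by (simp add: x_def)
  qed
  moreover have "lap (edges G) x w = k * x w" if w: "w \<in> verts G2" for w
  proof -
    have w': "w \<notin> verts G1" using w disj by blast
    have "lap (edges G) x w = lap (edges G2) x w"
      using fnb(2) vn(2) xuv w uv(2) by (cases "w = v") (simp_all add: lap_def n2)
    also have "\<dots> = b * lap (edges G2) x2 w"
      using w' nb(2)[of w] disj unfolding lap_def sum_distrib_left
      by (intro sum.cong) (auto simp: x_def algebra_simps)
    finally show ?thesis using x2(2) w w' by (simp add: x_def)
  qed
  moreover have "\<exists>w\<in>verts G. x w \<noteq> 0"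
  proof (cases "a = 0")
    case True
    then have "b \<noteq> 0" using ab(2) by simp
    moreover obtain w where "w \<in> verts G2" "x2 w \<noteq> 0" using x2(1) by blast
    ultimately show ?thesis using disj by (intro bexI[of _ w]) (auto simp: x_def V)
  next
    case False
    moreover obtain w where "w \<in> verts G1" "x1 w \<noteq> 0" using x1(1) by blast
    ultimately show ?thesis by (intro bexI[of _ w]) (auto simp: x_def V)
  qed
  ultimately show ?thesis unfolding eigenvalue_laplacian_iff_lap[OF G'] V by blast
qed

theorem theorem11:
  fixes G1 G2 G :: "'a ugraph"
    and Ts Ts' :: "('a \<times> 'a ugraph) list"
  assumes "unicyclic G1" and "cycle_tree_family Ts" and "G1 = cycle_of_trees Ts"
    and "unicyclic G2" and "cycle_tree_family Ts'" and "G2 = cycle_of_trees Ts'"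
    and "has_perfect_matching G1" and "has_perfect_matching G2"
    and "eigenvalue (laplacian_matrix G1) 2" and "eigenvalue (laplacian_matrix G2) 2"
    and "one_edge_connection G1 G2 G"
  shows "[num_odd_trees Ts = 0] (mod 4) \<and> [num_odd_trees Ts' = 0] (mod 4) \<longleftrightarrow>
         eigenvalue (laplacian_matrix G) 2"
proof -
  have "simple_graph G1" "simple_graph G2" using assms(1,4) by (simp_all add: unicyclic_def)
  then show ?thesis
    using assms num_odd_trees_mod_4_if_eigenvalue_2 eigenvalue_laplacian_one_edge_connection by blast
qed

end
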